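(* Let $B$ be a semi-Boolean restriction semigroup with projections $P$. Then the ultrafilter semicategory $\mathcal U(B)$ is a category if and only if every element of $B$ is a finite join (in the poset $B$) of elements of $PB=\{pb:p\in P,\ b\in B\}$.
   Context: **Restriction semigroups.** Let $B$ be a semigroup with a distinguished commutative subsemigroup $P$ of idempotents ("projections"). Write $a\leq b$ iff $a=bp$ for some $p\in P$; $\mathsf s(a)=\min\{p\in P:ap=a\}$ if it exists. $B$ is a restriction semigroup relative to $P$ if every element has a source projection $\mathsf s(a)$ (then $\leq$ is a partial order), $\mathsf s(ab)=\mathsf s(\mathsf s(a)b)$ for all $a,b\in B$, and $pb\leq b$ for all $p\in P$, $b\in B$. **Semi-Boolean.** A poset is a semi-Boolean algebra if every pair of elements has a meet and every principal ideal $\{c:c\leq b\}$ is a Boolean algebra. A semi-Boolean restriction semigroup is a restriction semigroup $B$ with an element $0\in P$ satisfying $0b=0$ for all $b\in B$ (then $0$ is also a right zero and the minimum of $B$), such that $(B,\leq)$ is a semi-Boolean algebra and $(a\vee b)c=ac\vee bc$ for all $a,b,c\in B$ with $a,b$ having an upper bound. **Ultrafilter semicategory.** A filter in the poset $B$ is a non-empty up-set $F$ such that any $a,b\in F$ have a common lower bound in $F$; it is proper if $F\neq B$; an ultrafilter is a maximal proper filter. $\mathcal U(B)$ is the set of ultrafilters with partial product $V\cdot W=\{c\in B:\exists v\in V,w\in W,\ vw\leq c\}$, defined precisely when $0\notin VW=\{vw:v\in V,w\in W\}$. It is a semicategory in the following sense. **Semicategories and categories.** A semigroupoid is a set $S$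 with a product defined on some pairs $S^2\subseteq S\times S$ such that $(ab)c$ is defined iff $a(bc)$ is defined, in which case they are equal. Its units are $S^0=\{u\in S:\forall a\in S\ [(u,a)\in S^2\Rightarrow ua=a]\text{ and }[(a,u)\in S^2\Rightarrow au=a]\}$. The source unit $\mathsf s(a)$ is the (unique, if it exists) $u\in S^0$ with $(a,u)\in S^2$; the range unit $\mathsf r(a)$ is the (unique, if it exists) $u\in S^0$ with $(u,a)\in S^2$. $S$ is a semicategory if every $a\in S$ has a source unit and $S^2=\{(a,b):\mathsf r(b)\text{ exists and }\mathsf s(a)=\mathsf r(b)\}$. A category is a semicategory in which every element also has a range unit. *)

theory Defs
  imports Main "HOL-Algebra.Lattice"
begin

section \<open>Semigroupoids, semicategories and categories\<close>

text \<open>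
  A partial product on a set \<open>S\<close> is given by its domain of definition \<open>D\<close>, a set of pairs, together
  with a total function whose values outside \<open>D\<close> are irrelevant.
\<close>

locale semigroupoid =
  fixes S :: "'x set"
    and D :: "('x \<times> 'x) set"
    and comp :: "'x \<Rightarrow> 'x \<Rightarrow> 'x"  (infixl "\<odot>" 70)
  assumes dom_subset: "D \<subseteq> S \<times> S"
    and comp_closed: "(a, b) \<in> D \<Longrightarrow> a \<odot> b \<in> S"
    and assoc_defined: "\<lbrakk>a \<in> S; b \<in> S; c \<in> S\<rbrakk> \<Longrightarrow>
          (a, b) \<in> D \<and> (a \<odot> b, c) \<in> D \<longleftrightarrow> (b, c) \<in> D \<and> (a, b \<odot> c) \<in> D"
    and assoc: "\<lbrakk>(a, b) \<in> D; (a \<odot> b, c) \<in> D\<rbrakk> \<Longrightarrow> (a \<odot> b) \<odot> c = a \<odot> (b \<odot> c)"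
begin

definition units :: "'x set" where
  "units = {u \<in> S. \<forall>a\<in>S. ((u, a) \<in> D \<longrightarrow> u \<odot> a = a) \<and> ((a, u) \<in> D \<longrightarrow> a \<odot> u = a)}"

definition is_source_unit :: "'x \<Rightarrow> 'x \<Rightarrow> bool" where
  "is_source_unit a u \<longleftrightarrow> u \<in> units \<and> (a, u) \<in> D"

definition is_range_unit :: "'x \<Rightarrow> 'x \<Rightarrow> bool" where
  "is_range_unit a u \<longleftrightarrow> u \<in> units \<and> (u, a) \<in> D"

lemma source_unit_unique:
  assumes "is_source_unit a u" "is_source_unit a v"
  shows "u = v"
proof -
  have u: "u \<in> units" "(a, u) \<in> D" and v: "v \<in> units" "(a, v) \<in> D"
    using assms by (auto simp: is_source_unit_def)
  have S: "a \<in> S" "u \<in> S" "v \<in> S"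
    using u v dom_subset by auto
  have "a \<odot> u = a"
    using u S by (auto simp: units_def)
  then have "(u, v) \<in> D"
    using assoc_defined [OF S] u v by simp
  then show ?thesis
    using u v S by (auto simp: units_def)
qed

lemma range_unit_unique:
  assumes "is_range_unit a u" "is_range_unit a v"
  shows "u = v"
proof -
  have u: "u \<in> units" "(u, a) \<in> D" and v: "v \<in> units" "(v, a) \<in> D"
    using assms by (auto simp: is_range_unit_def)
  have S: "a \<in> S" "u \<in> S" "v \<in> S"
    using u v dom_subset by auto
  have "v \<odot> a = a"
    using v S by (auto simp: units_def)
  then have "(u, v) \<in> D"
    using assoc_defined [OF S(2,3,1)] u v by simp
  then show ?thesis
    using u v S by (auto simp: units_def)
qed

text \<open>The two functions below are only meaningful if a source, respectively range, unit exists.\<close>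

definition source_unit :: "'x \<Rightarrow> 'x" where
  "source_unit a = (THE u. is_source_unit a u)"

definition range_unit :: "'x \<Rightarrow> 'x" where
  "range_unit a = (THE u. is_range_unit a u)"

end

locale semicategory = semigroupoid +
  assumes source_unit_exists: "a \<in> S \<Longrightarrow> \<exists>u. is_source_unit a u"
    and dom_eq: "D = {(a, b). a \<in> S \<and> b \<in> S \<and> (\<exists>u. is_range_unit b u) \<and> source_unit a = range_unit b}"

locale category = semicategory +
  assumes range_unit_exists: "a \<in> S \<Longrightarrow> \<exists>u. is_range_unit a u"


section \<open>Semi-Boolean algebras and ultrafilters in posets\<close>

locale boolean_algebra_poset = bounded_lattice L for L (structure) +
  assumes meet_join_distrib: "\<lbrakk>x \<in> carrier L; y \<in> carrier L; w \<in> carrier L\<rbrakk> \<Longrightarrow>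
            x \<sqinter> (y \<squnion> w) = (x \<sqinter> y) \<squnion> (x \<sqinter> w)"
    and complement_exists: "x \<in> carrier L \<Longrightarrow>
            \<exists>y\<in>carrier L. x \<sqinter> y = \<bottom> \<and> x \<squnion> y = \<top>"

definition principal_ideal :: "'a gorder \<Rightarrow> 'a \<Rightarrow> 'a gorder" where
  "principal_ideal L b = L\<lparr>carrier := {c \<in> carrier L. c \<sqsubseteq>\<^bsub>L\<^esub> b}\<rparr>"

definition semi_boolean_algebra :: "'a gorder \<Rightarrow> bool" where
  "semi_boolean_algebra L \<longleftrightarrow>
     lower_semilattice L \<and> (\<forall>b\<in>carrier L. boolean_algebra_poset (principal_ideal L b))"

definition poset_filter :: "'a gorder \<Rightarrow> 'a set \<Rightarrow> bool" where
  "poset_filter L F \<longleftrightarrow>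
     F \<subseteq> carrier L \<and> F \<noteq> {} \<and>
     (\<forall>a\<in>F. \<forall>b\<in>carrier L. a \<sqsubseteq>\<^bsub>L\<^esub> b \<longrightarrow> b \<in> F) \<and>
     (\<forall>a\<in>F. \<forall>b\<in>F. \<exists>c\<in>F. c \<sqsubseteq>\<^bsub>L\<^esub> a \<and> c \<sqsubseteq>\<^bsub>L\<^esub> b)"

definition poset_ultrafilter :: "'a gorder \<Rightarrow> 'a set \<Rightarrow> bool" where
  "poset_ultrafilter L F \<longleftrightarrow>
     poset_filter L F \<and> F \<noteq> carrier L \<and>
     (\<forall>G. poset_filter L G \<and> G \<noteq> carrier L \<and> F \<subseteq> G \<longrightarrow> G = F)"


section \<open>Restriction semigroups\<close>

text \<open>The semigroup \<open>B\<close> is the whole type \<open>'a\<close>.\<close>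

definition proj_order :: "'a::semigroup_mult set \<Rightarrow> 'a gorder" where
  "proj_order P = \<lparr>carrier = UNIV, eq = (=), le = (\<lambda>a b. \<exists>p\<in>P. a = b * p)\<rparr>"

definition is_source_proj :: "'a::semigroup_mult set \<Rightarrow> 'a \<Rightarrow> 'a \<Rightarrow> bool" where
  "is_source_proj P a s \<longleftrightarrow> least (proj_order P) s {p \<in> P. a * p = a}"

text \<open>On \<open>P\<close> the order is antisymmetric, by commutativity, so a source projection is unique.\<close>

definition source_proj :: "'a::semigroup_mult set \<Rightarrow> 'a \<Rightarrow> 'a" where
  "source_proj P a = (THE s. is_source_proj P a s)"

locale restriction_semigroup =
  fixes P :: "'a::semigroup_mult set"
  assumes proj_closed: "\<lbrakk>p \<in> P; q \<in> P\<rbrakk> \<Longrightarrow> p * q \<in> P"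
    and proj_commute: "\<lbrakk>p \<in> P; q \<in> P\<rbrakk> \<Longrightarrow> p * q = q * p"
    and proj_idem: "p \<in> P \<Longrightarrow> p * p = p"
    and source_proj_exists: "\<exists>s. is_source_proj P a s"
    and source_proj_mult: "source_proj P (a * b) = source_proj P (source_proj P a * b)"
    and proj_mult_le: "p \<in> P \<Longrightarrow> p * b \<sqsubseteq>\<^bsub>proj_order P\<^esub> b"

text \<open>
  In \<open>join_mult\<close> both joins exist: bounded pairs have joins since principal ideals are Boolean
  algebras (and binary meets exist), and right multiplication is monotone, so \<open>a * c\<close> and \<open>b * c\<close>
  are bounded whenever \<open>a\<close> and \<open>b\<close> are.
\<close>

locale semi_boolean_restriction_semigroup = restriction_semigroup P
  for P :: "'a::semigroup_mult set" +
  fixes z :: 'a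
  assumes zero_proj: "z \<in> P"
    and zero_mult: "z * b = z"
    and semi_boolean: "semi_boolean_algebra (proj_order P)"
    and join_mult: "Upper (proj_order P) {a, b} \<noteq> {} \<Longrightarrow>
          (a \<squnion>\<^bsub>proj_order P\<^esub> b) * c = (a * c) \<squnion>\<^bsub>proj_order P\<^esub> (b * c)"


section \<open>The partial product of ultrafilters\<close>

definition ultrafilters :: "'a::semigroup_mult set \<Rightarrow> 'a set set" where
  "ultrafilters P = {F. poset_ultrafilter (proj_order P) F}"

definition ultrafilter_dom :: "'a::semigroup_mult set \<Rightarrow> 'a \<Rightarrow> ('a set \<times> 'a set) set" where
  "ultrafilter_dom P z =
     {(V, W). V \<in> ultrafilters P \<and> W \<in> ultrafilters P \<and> z \<notin> {v * w | v w. v \<in> V \<and> w \<in> W}}"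

definition ultrafilter_mult :: "'a::semigroup_mult set \<Rightarrow> 'a set \<Rightarrow> 'a set \<Rightarrow> 'a set" where
  "ultrafilter_mult P V W = {c. \<exists>v\<in>V. \<exists>w\<in>W. v * w \<sqsubseteq>\<^bsub>proj_order P\<^esub> c}"

text \<open>
  The finite set \<open>A\<close> may be empty; its join is then the minimum of the poset, if there is one.
\<close>

definition is_finite_join_of :: "'a gorder \<Rightarrow> 'a set \<Rightarrow> 'a \<Rightarrow> bool" where
  "is_finite_join_of L X b \<longleftrightarrow> (\<exists>A. finite A \<and> A \<subseteq> X \<and> least L b (Upper L A))"

end

theory Submission
  imports Defs
begin

text \<open>
  If \<open>(V, W)\<close> is in the domain, then \<open>W\<close> is closed under left multiplication by \<open>s(v)\<close> for
  \<open>v \<in> V\<close>, so \<open>V \<cdot> W\<close> is the up-closure of \<open>vW\<close> for a single \<open>v \<in> V\<close>, and it inherits maximality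
  from \<open>W\<close>. The units are the ultrafilters containing a projection, and the source unit of \<open>V\<close> is
  generated by \<open>s(V)\<close>. If \<open>pb \<in> W\<close> with \<open>p \<in> P\<close>, then the projections \<open>q\<close> with \<open>qW \<subseteq> W\<close> generate a
  range unit of \<open>W\<close>: distributivity of the product over joins and primality of \<open>W\<close> make the
  generated filter maximal. Conversely, a range unit of \<open>W\<close> contains a projection that multiplies
  \<open>W\<close> into \<open>W\<close>. Hence \<open>U(B)\<close> is a category iff every ultrafilter meets \<open>PB\<close>, and since \<open>PB\<close> is a
  down-set, this is a compactness statement about finite joins.
\<close>

section \<open>Order, projections and sources\<close>

context semi_boolean_restriction_semigroup
begin

abbreviation below :: "'a \<Rightarrow> 'a \<Rightarrow> bool"  (infix "\<preceq>" 50) where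
  "a \<preceq> b \<equiv> a \<sqsubseteq>\<^bsub>proj_order P\<^esub> b"

abbreviation src :: "'a \<Rightarrow> 'a" where
  "src \<equiv> source_proj P"

text \<open>Expresses that the meet of \<open>a\<close> and \<open>b\<close> is \<open>z\<close>
  through lower bounds alone, so that no meet operation has to be carried along.\<close>

definition disj :: "'a \<Rightarrow> 'a \<Rightarrow> bool" where
  "disj a b \<longleftrightarrow> (\<forall>x. x \<preceq> a \<longrightarrow> x \<preceq> b \<longrightarrow> x = z)"

lemma below_iff: "a \<preceq> b \<longleftrightarrow> (\<exists>p\<in>P. a = b * p)"
  by (simp add: proj_order_def)

lemma lower_semilattice_proj_order: "lower_semilattice (proj_order P)"
  using semi_boolean by (simp add: semi_boolean_algebra_def)

text \<open>Antisymmetry is taken from the semi-Boolean axiom, since a lower semilattice is a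
  partial order; uniqueness of sources then follows from it.\<close>

lemma below_antisym: "a \<preceq> b \<Longrightarrow> b \<preceq> a \<Longrightarrow> a = b"
proof -
  assume "a \<preceq> b" "b \<preceq> a"
  interpret lower_semilattice "proj_order P"
    by (rule lower_semilattice_proj_order)
  show ?thesis
    using le_antisym [OF \<open>a \<preceq> b\<close> \<open>b \<preceq> a\<close>] by (simp add: proj_order_def)
qed

lemma below_trans [trans]: "a \<preceq> b \<Longrightarrow> b \<preceq> c \<Longrightarrow> a \<preceq> c"
  by (auto simp: below_iff mult.assoc intro: proj_closed)

lemma is_source_proj_src: "is_source_proj P a (src a)"
proof -
  obtain s where s: "is_source_proj P a s"
    using source_proj_exists by blast
  have "t = s" if "is_source_proj P a t" for t
    using s that below_antisym unfolding is_source_proj_def least_def by blast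
  then show ?thesis
    unfolding source_proj_def using s by (metis theI)
qed

lemma src_closed [simp]: "src a \<in> P"
  using is_source_proj_src [of a] by (simp add: is_source_proj_def least_def)

lemma mult_src [simp]: "a * src a = a"
  using is_source_proj_src [of a] by (simp add: is_source_proj_def least_def)

lemma src_least: "p \<in> P \<Longrightarrow> a * p = a \<Longrightarrow> src a \<preceq> p"
  using is_source_proj_src [of a] by (simp add: is_source_proj_def least_def)

lemma below_refl [simp]: "a \<preceq> a"
  unfolding below_iff by (metis mult_src src_closed)

lemma below_projD:
  assumes "a \<preceq> p" "p \<in> P" shows "a \<in> P" "p * a = a" "a * p = a"
  using assms by (auto simp: below_iff proj_closed mult.assoc [symmetric] proj_idem)
    (metis proj_commute proj_idem mult.assoc)

lemma src_proj [simp]: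
  assumes "p \<in> P" shows "src p = p"
proof (rule below_antisym)
  show "src p \<preceq> p"
    by (simp add: assms proj_idem src_least)
  then show "p \<preceq> src p"
    using below_projD(2) [of "src p" p] assms by simp
qed

lemma mult_proj_below: "p \<in> P \<Longrightarrow> a * p \<preceq> a"
  by (auto simp: below_iff)

lemma below_mult_left: "a \<preceq> b \<Longrightarrow> c * a \<preceq> c * b"
  by (auto simp: below_iff mult.assoc)

text \<open>If \<open>a = b * p\<close> then \<open>a * c = b * (p * c)\<close>, and the axiom
  \<open>p * c \<preceq> c\<close> finishes. This is where left multiplication by projections must
  be decreasing.\<close>

lemma below_mult_right:
  assumes "a \<preceq> b" shows "a * c \<preceq> b * c"
proof -
  obtain p where "p \<in> P" "a = b * p"
    using assms by (auto simp: below_iff)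
  then show ?thesis
    using below_mult_left [OF proj_mult_le] by (simp add: mult.assoc)
qed

lemma below_mult: "a \<preceq> b \<Longrightarrow> c \<preceq> d \<Longrightarrow> a * c \<preceq> b * d"
  using below_mult_left below_mult_right below_trans by blast

text \<open>Any \<open>p\<close> with \<open>a = b * p\<close> lies above \<open>src a\<close>,
  hence can be shrunk to it. So an element below \<open>b\<close> is recovered from its
  source.\<close>

lemma below_eq_mult_src:
  assumes "a \<preceq> b" shows "b * src a = a"
proof -
  obtain p where p: "p \<in> P" "a = b * p"
    using assms by (auto simp: below_iff)
  then have "src a \<preceq> p"
    by (intro src_least) (simp_all add: mult.assoc proj_idem)
  then show ?thesis
    using p below_projD(2) by (metis mult.assoc mult_src)
qed

lemma src_mult_proj: "p \<in> P \<Longrightarrow> src (a * p) = src a * p"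
  by (metis proj_closed source_proj_mult src_closed src_proj)

lemma src_mono: "a \<preceq> b \<Longrightarrow> src a \<preceq> src b"
  by (auto simp: below_iff src_mult_proj)

lemma zero_below [simp]: "z \<preceq> a"
  using proj_mult_le [OF zero_proj] by (simp add: zero_mult)

lemma below_zero [simp]: "a \<preceq> z \<longleftrightarrow> a = z"
  using below_antisym by auto

lemma mult_zero: "a * z = z"
  by (metis below_eq_mult_src src_proj zero_below zero_proj)

lemma src_eq_zero [simp]: "src a = z \<longleftrightarrow> a = z"
  by (metis below_eq_mult_src mult_src src_proj zero_below zero_proj)

text \<open>Whether a product vanishes depends on its left factor only through the source; this
  links composability of ultrafilters to source units.\<close>

lemma mult_eq_zero_iff_src: "a * b = z \<longleftrightarrow> src a * b = z"
  by (metis source_proj_mult src_eq_zero)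

section \<open>Meets, bounded joins and relative complements\<close>

lemma meet_exists:
  obtains m where "m \<preceq> a" "m \<preceq> b" "\<And>x. x \<preceq> a \<Longrightarrow> x \<preceq> b \<Longrightarrow> x \<preceq> m"
proof -
  interpret lower_semilattice "proj_order P"
    by (rule lower_semilattice_proj_order)
  have "a \<in> carrier (proj_order P)" "b \<in> carrier (proj_order P)"
    by (simp_all add: proj_order_def)
  then obtain m where "greatest (proj_order P) m (Lower (proj_order P) {a, b})"
    using inf_of_two_exists by blast
  then show thesis
    by (intro that [of m]) (auto simp: greatest_def Lower_def proj_order_def)
qed

lemma lub_iff:
  "least (proj_order P) j (Upper (proj_order P) A) \<longleftrightarrow>
     (\<forall>a\<in>A. a \<preceq> j) \<and> (\<forall>u. (\<forall>a\<in>A. a \<preceq> u) \<longrightarrow> j \<preceq> u)"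
  by (auto simp: least_def Upper_def proj_order_def)

text \<open>A join computed inside the ideal below \<open>b\<close> is a join in all of
  \<open>B\<close>: meeting an arbitrary upper bound \<open>u\<close> with \<open>b\<close> brings
  it into the ideal.\<close>

lemma least_principal_ideal:
  assumes "least (principal_ideal (proj_order P) b) j
             (Upper (principal_ideal (proj_order P) b) {a, c})"
    and "a \<preceq> b" "c \<preceq> b"
  shows "a \<preceq> j" "c \<preceq> j" "a \<preceq> u \<Longrightarrow> c \<preceq> u \<Longrightarrow> j \<preceq> u"
proof -
  have j: "a \<preceq> j" "c \<preceq> j" "j \<preceq> b" "\<And>x. x \<preceq> b \<Longrightarrow> a \<preceq> x \<Longrightarrow> c \<preceq> x \<Longrightarrow> j \<preceq> x"
    using assms by (auto simp: least_def Upper_def principal_ideal_def proj_order_def)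
  then show "a \<preceq> j" "c \<preceq> j" by auto
  assume "a \<preceq> u" "c \<preceq> u"
  obtain m where m: "m \<preceq> u" "m \<preceq> b" "\<And>x. x \<preceq> u \<Longrightarrow> x \<preceq> b \<Longrightarrow> x \<preceq> m"
    using meet_exists [of u b] by metis
  then show "j \<preceq> u"
    using \<open>a \<preceq> u\<close> \<open>c \<preceq> u\<close> assms j below_trans by meson
qed

lemma boolean_principal_ideal: "boolean_algebra_poset (principal_ideal (proj_order P) b)"
  using semi_boolean by (simp add: semi_boolean_algebra_def proj_order_def)

lemma bounded_lub_exists:
  assumes "a \<preceq> b" "c \<preceq> b"
  shows "\<exists>j. least (proj_order P) j (Upper (proj_order P) {a, c})"
proof -
  let ?I = "principal_ideal (proj_order P) b"
  interpret boolean_algebra_poset ?I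
    by (rule boolean_principal_ideal)
  have "a \<in> carrier ?I" "c \<in> carrier ?I"
    using assms by (simp_all add: principal_ideal_def proj_order_def)
  then obtain j where "least ?I j (Upper ?I {a, c})"
    using sup_of_two_exists by blast
  then show ?thesis
    using least_principal_ideal [OF _ assms] unfolding lub_iff by blast
qed

lemma complement_exists:
  assumes "w \<preceq> b"
  obtains w' where "w' \<preceq> b" "disj w w'" "\<And>x. x \<preceq> b \<Longrightarrow> disj x w \<Longrightarrow> x \<preceq> w'"
    "\<And>u. w \<preceq> u \<Longrightarrow> w' \<preceq> u \<Longrightarrow> b \<preceq> u"
proof -
  let ?I = "principal_ideal (proj_order P) b"
  interpret boolean_algebra_poset ?I
    by (rule boolean_principal_ideal)
  have C: "c \<in> carrier ?I \<longleftrightarrow> c \<preceq> b" and le: "le ?I = le (proj_order P)"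
    and eq: "eq ?I = (=)" for c
    by (simp_all add: principal_ideal_def proj_order_def)
  have bot: "\<bottom>\<^bsub>?I\<^esub> = z"
    by (metis C bottom_closed bottom_lower below_zero le zero_below)
  have top: "\<top>\<^bsub>?I\<^esub> = b"
    by (metis C below_antisym below_refl le top_closed top_higher)
  obtain w' where w': "w' \<preceq> b" "w \<sqinter>\<^bsub>?I\<^esub> w' = z" "w \<squnion>\<^bsub>?I\<^esub> w' = b"
    using complement_exists [of w] assms by (auto simp: C bot top)
  have w: "w \<in> carrier ?I" "w' \<in> carrier ?I"
    using assms w' by (simp_all add: C)
  show thesis
  proof
    show "w' \<preceq> b" by fact
    show disj: "disj w w'"
      unfolding disj_def
    proof (intro allI impI)
      fix x assume "x \<preceq> w" "x \<preceq> w'"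
      then have "x \<sqsubseteq>\<^bsub>?I\<^esub> w \<sqinter>\<^bsub>?I\<^esub> w'"
        using w assms below_trans by (intro meet_le) (auto simp: C le)
      then show "x = z"
        by (simp add: w' le)
    qed
    show "x \<preceq> w'" if "x \<preceq> b" "disj x w" for x
    proof -
      have x: "x \<in> carrier ?I" using that by (simp add: C)
      \<comment> \<open>Distributivity splits \<open>x\<close> along \<open>w\<close> and its
        complement; the part in \<open>w\<close> is zero by disjointness.\<close>
      have "x = x \<sqinter>\<^bsub>?I\<^esub> (w \<squnion>\<^bsub>?I\<^esub> w')"
        using that x by (metis C below_antisym below_refl le meet_le meet_left w'(3))
      also have "\<dots> = (x \<sqinter>\<^bsub>?I\<^esub> w) \<squnion>\<^bsub>?I\<^esub> (x \<sqinter>\<^bsub>?I\<^esub> w')"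
        using x w by (rule meet_join_distrib)
      also have "x \<sqinter>\<^bsub>?I\<^esub> w = z"
        using that(2) meet_left [OF x w(1)] meet_right [OF x w(1)] by (simp add: disj_def le)
      also have "z \<squnion>\<^bsub>?I\<^esub> (x \<sqinter>\<^bsub>?I\<^esub> w') \<preceq> w'"
      proof -
        have "z \<squnion>\<^bsub>?I\<^esub> (x \<sqinter>\<^bsub>?I\<^esub> w') \<sqsubseteq>\<^bsub>?I\<^esub> w'"
          using meet_right [OF x w(2)] meet_closed [OF x w(2)] w by (intro join_le) (simp_all add: le C)
        then show ?thesis by (simp add: le)
      qed
      finally show ?thesis .
    qed
    show "b \<preceq> u" if "w \<preceq> u" "w' \<preceq> u" for u
    proof -
      have "least ?I (w \<squnion>\<^bsub>?I\<^esub> w') (Upper ?I {w, w'})"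
        using sup_of_two_exists [OF w] unfolding join_def sup_def
        by (metis (mono_tags, lifting) someI_ex)
      then show ?thesis
        using least_principal_ideal(3) assms w'(1,3) that by metis
    qed
  qed
qed


section \<open>Filters and ultrafilters\<close>

lemma filterI:
  assumes "x \<in> F" "\<And>a b. a \<in> F \<Longrightarrow> a \<preceq> b \<Longrightarrow> b \<in> F"
    "\<And>a b. a \<in> F \<Longrightarrow> b \<in> F \<Longrightarrow> \<exists>c\<in>F. c \<preceq> a \<and> c \<preceq> b"
  shows "poset_filter (proj_order P) F"
  using assms unfolding poset_filter_def by (auto simp: proj_order_def)

lemma filter_up: "poset_filter (proj_order P) F \<Longrightarrow> a \<in> F \<Longrightarrow> a \<preceq> b \<Longrightarrow> b \<in> F"
  unfolding poset_filter_def by (auto simp: proj_order_def)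

lemma filter_lower_bound:
  assumes "poset_filter (proj_order P) F" "a \<in> F" "b \<in> F"
  obtains c where "c \<in> F" "c \<preceq> a" "c \<preceq> b"
  using assms unfolding poset_filter_def by meson

lemma filter_nonempty:
  assumes "poset_filter (proj_order P) F"
  obtains x where "x \<in> F"
  using assms unfolding poset_filter_def by blast

lemma filter_proper_iff:
  assumes "poset_filter (proj_order P) F"
  shows "F \<noteq> carrier (proj_order P) \<longleftrightarrow> z \<notin> F"
proof -
  have "carrier (proj_order P) = UNIV"
    by (simp add: proj_order_def)
  then show ?thesis
    using filter_up [OF assms _ zero_below] by blast
qed

lemma ultrafilters_maximal_iff:
  "V \<in> ultrafilters P \<longleftrightarrow> poset_filter (proj_order P) V \<and> z \<notin> V \<and>
     (\<forall>G. poset_filter (proj_order P) G \<longrightarrow> z \<notin> G \<longrightarrow> V \<subseteq> G \<longrightarrow> G = V)"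
  unfolding ultrafilters_def poset_ultrafilter_def mem_Collect_eq
  using filter_proper_iff by metis

text \<open>If no \<open>v \<in> V\<close> is disjoint from \<open>c\<close>, then adjoining
  \<open>c\<close> to \<open>V\<close> gives a proper filter, so maximality forces
  \<open>c \<in> V\<close>. Conversely, members of a proper filter containing \<open>V\<close> are
  disjoint from no element of \<open>V\<close>. Maximality thus becomes a test on single elements,
  used for every construction below.\<close>

lemma ultrafilter_iff:
  "V \<in> ultrafilters P \<longleftrightarrow>
     poset_filter (proj_order P) V \<and> z \<notin> V \<and> (\<forall>c. (\<forall>v\<in>V. \<not> disj c v) \<longrightarrow> c \<in> V)"
    (is "?L \<longleftrightarrow> ?R")
proof
  assume ?L
  then have V: "poset_filter (proj_order P) V" "z \<notin> V"
    and max: "\<And>G. poset_filter (proj_order P) G \<Longrightarrow> z \<notin> G \<Longrightarrow> V \<subseteq> G \<Longrightarrow> G = V"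
    by (simp_all add: ultrafilters_maximal_iff)
  have "c \<in> V" if c: "\<forall>v\<in>V. \<not> disj c v" for c
  proof -
    \<comment> \<open>The filter generated by \<open>V\<close> and \<open>c\<close>: the condition
      says that the meet of \<open>c\<close> and \<open>v\<close> lies below \<open>x\<close>. It
      contains \<open>z\<close> only if some \<open>v\<close> is disjoint from
      \<open>c\<close>.\<close>
    let ?G = "{x. \<exists>v\<in>V. \<forall>y. y \<preceq> c \<longrightarrow> y \<preceq> v \<longrightarrow> y \<preceq> x}"
    obtain v0 where "v0 \<in> V"
      using V filter_nonempty by blast
    then have "c \<in> ?G"
      by auto
    have "poset_filter (proj_order P) ?G"
    proof (rule filterI)
      show "c \<in> ?G" by fact
      show "b \<in> ?G" if "a \<in> ?G" "a \<preceq> b" for a b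
        using that below_trans by blast
      fix a b assume "a \<in> ?G" "b \<in> ?G"
      then obtain v w where vw: "v \<in> V" "\<And>y. y \<preceq> c \<Longrightarrow> y \<preceq> v \<Longrightarrow> y \<preceq> a"
          "w \<in> V" "\<And>y. y \<preceq> c \<Longrightarrow> y \<preceq> w \<Longrightarrow> y \<preceq> b"
        by auto
      obtain x where x: "x \<in> V" "x \<preceq> v" "x \<preceq> w"
        using filter_lower_bound [OF V(1) vw(1) vw(3)] .
      obtain m where m: "m \<preceq> a" "m \<preceq> b" "\<And>y. y \<preceq> a \<Longrightarrow> y \<preceq> b \<Longrightarrow> y \<preceq> m"
        using meet_exists [of a b] by metis
      have "m \<in> ?G"
      proof (intro CollectI bexI [of _ x] allI impI m(3) x(1))
        fix y assume "y \<preceq> c" "y \<preceq> x"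
        then show "y \<preceq> a" "y \<preceq> b"
          using x(2,3) vw(2,4) below_trans by blast+
      qed
      then show "\<exists>c\<in>?G. c \<preceq> a \<and> c \<preceq> b"
        using m by blast
    qed
    moreover have "z \<notin> ?G"
      using c by (auto simp: disj_def)
    ultimately have "?G = V"
      by (rule max) auto
    then show ?thesis
      using \<open>c \<in> ?G\<close> by simp
  qed
  then show ?R
    using V by blast
next
  assume R: ?R
  have "G = V" if G: "poset_filter (proj_order P) G" "z \<notin> G" "V \<subseteq> G" for G
  proof (rule antisym)
    show "G \<subseteq> V"
    proof
      fix c assume "c \<in> G"
      have "\<not> disj c v" if v: "v \<in> V" for v
      proof -
        obtain x where "x \<in> G" "x \<preceq> c" "x \<preceq> v"
          using filter_lower_bound [OF G(1) \<open>c \<in> G\<close>] v G(3) by blast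
        then show ?thesis
          using G(2) by (auto simp: disj_def)
      qed
      then show "c \<in> V"
        using R by blast
    qed
  qed (fact G(3))
  then show ?L
    using R by (simp add: ultrafilters_maximal_iff)
qed

lemma ultrafilter_filter: "V \<in> ultrafilters P \<Longrightarrow> poset_filter (proj_order P) V"
  and ultrafilter_zero: "V \<in> ultrafilters P \<Longrightarrow> z \<notin> V"
  and ultrafilter_mem: "V \<in> ultrafilters P \<Longrightarrow> (\<And>v. v \<in> V \<Longrightarrow> \<not> disj c v) \<Longrightarrow> c \<in> V"
  by (auto simp: ultrafilter_iff)

lemmas ultrafilter_up = filter_up [OF ultrafilter_filter]
lemmas ultrafilter_lower_bound = filter_lower_bound [OF ultrafilter_filter]
lemmas ultrafilter_nonempty = filter_nonempty [OF ultrafilter_filter]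

lemma ultrafilter_subset_eq:
  "V \<in> ultrafilters P \<Longrightarrow> W \<in> ultrafilters P \<Longrightarrow> V \<subseteq> W \<Longrightarrow> V = W"
  unfolding ultrafilters_def poset_ultrafilter_def by blast

lemma filter_extends_to_ultrafilter:
  assumes F: "poset_filter (proj_order P) F" "z \<notin> F"
  obtains U where "U \<in> ultrafilters P" "F \<subseteq> U"
proof -
  let ?A = "{G. poset_filter (proj_order P) G \<and> z \<notin> G \<and> F \<subseteq> G}"
  have "\<exists>M\<in>?A. \<forall>X\<in>?A. M \<subseteq> X \<longrightarrow> X = M"
  proof (rule subset_Zorn_nonempty)
    show "?A \<noteq> {}" using F by blast
    fix C assume "C \<noteq> {}" and C: "subset.chain ?A C"
    then have sub: "C \<subseteq> ?A" and tot: "\<And>X Y. X \<in> C \<Longrightarrow> Y \<in> C \<Longrightarrow> X \<subseteq> Y \<or> Y \<subseteq> X"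
      by (auto simp: subset_chain_def)
    obtain G where G: "G \<in> C" using \<open>C \<noteq> {}\<close> by blast
    then obtain x where "x \<in> G"
      using sub filter_nonempty by blast
    have "poset_filter (proj_order P) (\<Union>C)"
    proof (rule filterI)
      show "x \<in> \<Union>C" using \<open>x \<in> G\<close> G by blast
      show "b \<in> \<Union>C" if "a \<in> \<Union>C" "a \<preceq> b" for a b
        using that sub filter_up by blast
      fix a b assume "a \<in> \<Union>C" "b \<in> \<Union>C"
      then obtain X where "X \<in> C" "a \<in> X" "b \<in> X"
        using tot by (metis UnionE subsetD)
      then show "\<exists>c\<in>\<Union>C. c \<preceq> a \<and> c \<preceq> b"
        using filter_lower_bound [of X a b] sub by blast
    qed
    then show "\<Union>C \<in> ?A"
      using sub G by blast
  qed
  then obtain M where M: "M \<in> ?A" "\<forall>X\<in>?A. M \<subseteq> X \<longrightarrow> X = M"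
    by (rule bexE)
  have "M \<in> ultrafilters P"
    unfolding ultrafilters_maximal_iff using M by auto
  then show thesis
    using that M(1) by blast
qed

text \<open>
  If no element of \<open>A\<close> lay in \<open>W\<close>, then \<open>W\<close> would contain some \<open>w \<preceq> b\<close> disjoint from all of \<open>A\<close>,
  and the complement of \<open>w\<close> below \<open>b\<close> would be a smaller upper bound of \<open>A\<close>.
\<close>

lemma ultrafilter_prime:
  assumes W: "W \<in> ultrafilters P" and "b \<in> W" "finite A"
    and lub: "least (proj_order P) b (Upper (proj_order P) A)"
  shows "\<exists>a\<in>A. a \<in> W"
proof (rule ccontr)
  assume no: "\<not> (\<exists>a\<in>A. a \<in> W)"
  have "\<exists>w\<in>W. w \<preceq> b \<and> (\<forall>a\<in>A'. disj a w)" if "A' \<subseteq> A" for A'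
    using finite_subset [OF that \<open>finite A\<close>] that
  proof (induction A' rule: finite_induct)
    case empty
    then show ?case using \<open>b \<in> W\<close> below_refl by blast
  next
    case (insert a A')
    then obtain w where w: "w \<in> W" "w \<preceq> b" "\<forall>a\<in>A'. disj a w"
      by blast
    obtain v where v: "v \<in> W" "disj a v"
      using ultrafilter_mem [OF W] no insert.prems by blast
    obtain u where u: "u \<in> W" "u \<preceq> w" "u \<preceq> v"
      using ultrafilter_lower_bound [OF W \<open>w \<in> W\<close> \<open>v \<in> W\<close>] .
    have "disj x u" if "disj x w \<or> disj x v" for x
      using that u below_trans unfolding disj_def by blast
    then show ?case
      using u v w below_trans by blast
  qed
  then obtain w where w: "w \<in> W" "w \<preceq> b" "\<And>a. a \<in> A \<Longrightarrow> disj a w"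
    by blast
  obtain w' where w': "w' \<preceq> b" "disj w w'" "\<And>x. x \<preceq> b \<Longrightarrow> disj x w \<Longrightarrow> x \<preceq> w'"
    using complement_exists [OF w(2)] by metis
  then have "b \<preceq> w'"
    using lub w(3) unfolding lub_iff by blast
  then have "w \<preceq> w'"
    using w(2) below_trans by blast
  then have "w = z"
    using w'(2) by (simp add: disj_def)
  then show False
    using w(1) ultrafilter_zero [OF W] by simp
qed


section \<open>The semicategory of ultrafilters\<close>

lemma dom_iff:
  "(V, W) \<in> ultrafilter_dom P z \<longleftrightarrow>
     V \<in> ultrafilters P \<and> W \<in> ultrafilters P \<and> (\<forall>v\<in>V. \<forall>w\<in>W. v * w \<noteq> z)"
  unfolding ultrafilter_dom_def by auto

text \<open>For \<open>u \<in> W\<close> below \<open>w\<close> and \<open>v\<close>, the nonzero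
  element \<open>p * u\<close> is below \<open>u\<close>, so it lies below both \<open>p * w\<close>
  and \<open>v\<close>; the disjointness test applies.\<close>

lemma proj_mult_mem:
  assumes W: "W \<in> ultrafilters P" and p: "p \<in> P" and nz: "\<And>w. w \<in> W \<Longrightarrow> p * w \<noteq> z"
    and "w \<in> W"
  shows "p * w \<in> W"
proof (rule ultrafilter_mem [OF W])
  fix v assume "v \<in> W"
  then obtain u where u: "u \<in> W" "u \<preceq> w" "u \<preceq> v"
    using ultrafilter_lower_bound [OF W \<open>w \<in> W\<close>] by blast
  have "p * u \<preceq> p * w" "p * u \<preceq> v"
    using u proj_mult_le [OF p] below_mult_left below_trans by blast+
  then show "\<not> disj (p * w) v"
    using nz [OF u(1)] by (auto simp: disj_def)
qed

lemma src_mult_mem: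
  assumes "(V, W) \<in> ultrafilter_dom P z" "v \<in> V" "w \<in> W"
  shows "src v * w \<in> W"
  using assms by (intro proj_mult_mem) (auto simp: dom_iff mult_eq_zero_iff_src [symmetric])

lemma ultrafilter_mult_closed:
  assumes D: "(V, W) \<in> ultrafilter_dom P z"
  shows "ultrafilter_mult P V W \<in> ultrafilters P"
  unfolding ultrafilter_iff
proof (intro conjI allI impI)
  let ?M = "ultrafilter_mult P V W"
  have V: "V \<in> ultrafilters P" and W: "W \<in> ultrafilters P"
    and nz: "\<And>v w. v \<in> V \<Longrightarrow> w \<in> W \<Longrightarrow> v * w \<noteq> z"
    using D by (auto simp: dom_iff)
  obtain v where v: "v \<in> V" using ultrafilter_nonempty [OF V] .
  obtain w1 where w1: "w1 \<in> W" using ultrafilter_nonempty [OF W] .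
  have mem: "a * b \<in> ?M" if "a \<in> V" "b \<in> W" for a b
    using that below_refl unfolding ultrafilter_mult_def by blast
  show "poset_filter (proj_order P) ?M"
  proof (rule filterI)
    show "v * w1 \<in> ?M" using mem v w1 by blast
    show "b \<in> ?M" if "a \<in> ?M" "a \<preceq> b" for a b
      using that below_trans unfolding ultrafilter_mult_def by blast
    fix a b assume "a \<in> ?M" "b \<in> ?M"
    then obtain v1 w1 v2 w2 where
      vw: "v1 \<in> V" "w1 \<in> W" "v1 * w1 \<preceq> a" "v2 \<in> V" "w2 \<in> W" "v2 * w2 \<preceq> b"
      unfolding ultrafilter_mult_def by blast
    obtain v3 where v3: "v3 \<in> V" "v3 \<preceq> v1" "v3 \<preceq> v2"
      using ultrafilter_lower_bound [OF V vw(1) vw(4)] .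
    obtain w3 where w3: "w3 \<in> W" "w3 \<preceq> w1" "w3 \<preceq> w2"
      using ultrafilter_lower_bound [OF W vw(2) vw(5)] .
    have "v3 * w3 \<preceq> a" "v3 * w3 \<preceq> b"
      using below_mult vw v3 w3 below_trans by meson+
    then show "\<exists>c\<in>?M. c \<preceq> a \<and> c \<preceq> b"
      using mem v3 w3 by blast
  qed
  show "z \<notin> ?M"
    using nz unfolding ultrafilter_mult_def by auto
  fix c assume c: "\<forall>m\<in>?M. \<not> disj c m"
  define w0 where "w0 = src v * w1"
  have w0: "w0 \<in> W"
    unfolding w0_def by (rule src_mult_mem [OF D v w1])
  have src_w0: "src v * w0 = w0"
    unfolding w0_def by (simp add: mult.assoc [symmetric] proj_idem)
  \<comment> \<open>The idea is to pull \<open>d\<close>, the meet of \<open>c\<close> with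
    \<open>v * w0\<close>, back along left multiplication by \<open>v\<close>: the restriction
    \<open>e\<close> of \<open>w0\<close> satisfies \<open>v * e = d\<close>. Once
    \<open>e \<in> W\<close>, the element \<open>c\<close> lies above a product from
    \<open>V\<close> and \<open>W\<close>.\<close>
  obtain d where d: "d \<preceq> c" "d \<preceq> v * w0" "\<And>x. x \<preceq> c \<Longrightarrow> x \<preceq> v * w0 \<Longrightarrow> x \<preceq> d"
    using meet_exists [of c "v * w0"] by metis
  define e where "e = w0 * src d"
  have ve: "v * e = d"
    using below_eq_mult_src [OF d(2)] by (simp add: e_def mult.assoc)
  have "e \<in> W"
  proof (rule ultrafilter_mem [OF W])
    fix w' assume "w' \<in> W"
    then obtain w where w: "w \<in> W" "w \<preceq> w'" "w \<preceq> w0"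
      using ultrafilter_lower_bound [OF W _ w0] by blast
    have "v * w \<in> ?M" using mem v w by blast
    then obtain x where x: "x \<preceq> c" "x \<preceq> v * w" "x \<noteq> z"
      using c by (auto simp: disj_def)
    have "x \<preceq> d"
      using x d(3) below_mult_left [OF w(3)] below_trans by blast
    have "x = d * src x" "x = v * w * src x"
      using \<open>x \<preceq> d\<close> x(2) by (simp_all add: below_eq_mult_src)
    \<comment> \<open>Both sides restrict \<open>w0\<close> by the commuting projections
      \<open>src d\<close> and \<open>src w\<close>. The left form is visibly below
      \<open>e\<close>, the right one below \<open>w\<close>, so only its being nonzero is
      left.\<close>
    have es: "e * src w = w * src d"
      using below_eq_mult_src [OF w(3)] proj_commute [OF src_closed src_closed]
      by (metis e_def mult.assoc)
    have "v * (e * src w) \<noteq> z"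
    proof
      assume "v * (e * src w) = z"
      then have "d * src w = z" 
        using ve by (simp add: mult.assoc [symmetric])
      then have "src d * src w = z"
        using mult_eq_zero_iff_src by blast
      \<comment> \<open>The nonzero \<open>x\<close> from the test on \<open>c\<close> contradicts
        vanishing: \<open>src x\<close> lies below both sources, hence below their product.\<close>
      moreover have "src x \<preceq> src d" "src x \<preceq> src w"
      proof -
        show "src x \<preceq> src d" using \<open>x \<preceq> d\<close> by (rule src_mono)
        have "v * w * src w = v * w" by (simp add: mult.assoc)
        then show "src x \<preceq> src w"
          using src_mono [OF x(2)] src_least [of "src w" "v * w"] below_trans by auto
      qed
      then have "src x = src d * src w * src x"
        using below_projD(2) by (metis mult.assoc src_closed)
      ultimately show False
        using x(3) by (simp add: zero_mult)
    qed
    then have "e * src w \<noteq> z"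
      using mult_zero by metis
    moreover have "e * src w \<preceq> e"
      by (simp add: mult_proj_below)
    moreover have "e * src w \<preceq> w'"
      unfolding es by (rule below_trans [OF mult_proj_below [OF src_closed] w(2)])
    ultimately show "\<not> disj e w'"
      by (auto simp: disj_def)
  qed
  then show "c \<in> ?M"
    using ve d(1) v unfolding ultrafilter_mult_def by blast
qed

text \<open>Each bracketing is defined exactly when no triple product vanishes, a condition
  indifferent to brackets. Nonemptiness of the third factor turns this into nonvanishing of the
  inner products.\<close>

lemma mult_assoc_dom_iff:
  assumes "V \<in> ultrafilters P" "W \<in> ultrafilters P" "X \<in> ultrafilters P"
  shows "(V, W) \<in> ultrafilter_dom P z \<and> (ultrafilter_mult P V W, X) \<in> ultrafilter_dom P z \<longleftrightarrow>
           (\<forall>v\<in>V. \<forall>w\<in>W. \<forall>x\<in>X. v * w * x \<noteq> z)" (is "?L \<longleftrightarrow> ?T")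
    and "(W, X) \<in> ultrafilter_dom P z \<and> (V, ultrafilter_mult P W X) \<in> ultrafilter_dom P z \<longleftrightarrow>
           (\<forall>v\<in>V. \<forall>w\<in>W. \<forall>x\<in>X. v * w * x \<noteq> z)" (is "?R \<longleftrightarrow> ?T")
proof -
  have mem: "a * b \<in> ultrafilter_mult P F G" if "a \<in> F" "b \<in> G" for a b F G
    using that below_refl unfolding ultrafilter_mult_def by blast
  obtain v0 w0 x0 where ne: "v0 \<in> V" "w0 \<in> W" "x0 \<in> X"
    using assms ultrafilter_nonempty by metis
  show "?L \<longleftrightarrow> ?T"
  proof
    assume T: ?T
    then have D: "(V, W) \<in> ultrafilter_dom P z"
      using assms ne by (auto simp: dom_iff) (metis zero_mult)
    moreover have "c * x \<noteq> z" if c: "c \<in> ultrafilter_mult P V W" "x \<in> X" for c x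
    proof -
      obtain v w where "v \<in> V" "w \<in> W" "v * w \<preceq> c"
        using c unfolding ultrafilter_mult_def by blast
      then show ?thesis
        using T c(2) below_mult_right [of "v * w" c x] by (metis below_zero)
    qed
    ultimately show ?L
      using assms ultrafilter_mult_closed [OF D] by (simp add: dom_iff)
  qed (use mem in \<open>auto simp: dom_iff\<close>)
  show "?R \<longleftrightarrow> ?T"
  proof
    assume T: ?T
    then have D: "(W, X) \<in> ultrafilter_dom P z"
      using assms ne by (auto simp: dom_iff mult.assoc) (metis mult_zero)
    moreover have "v * c \<noteq> z" if c: "c \<in> ultrafilter_mult P W X" "v \<in> V" for c v
    proof -
      obtain w x where "w \<in> W" "x \<in> X" "w * x \<preceq> c"
        using c unfolding ultrafilter_mult_def by blast
      then show ?thesis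
        using T c(2) below_mult_left [of "w * x" c v] by (metis below_zero mult.assoc)
    qed
    ultimately show ?R
      using assms ultrafilter_mult_closed [OF D] by (simp add: dom_iff)
  qed (use mem in \<open>auto simp: dom_iff mult.assoc\<close>)
qed

text \<open>Both sides are the up-closure of the triple products because multiplication is monotone;
  this holds for arbitrary sets, so no definedness enters.\<close>

lemma ultrafilter_mult_assoc:
  "ultrafilter_mult P (ultrafilter_mult P V W) X = ultrafilter_mult P V (ultrafilter_mult P W X)"
    (is "?L = ?R")
proof (rule Set.set_eqI, rule iffI)
  fix c assume "c \<in> ?L"
  then obtain v w x d where h: "v \<in> V" "w \<in> W" "x \<in> X" "v * w \<preceq> d" "d * x \<preceq> c"
    unfolding ultrafilter_mult_def by blast
  then have "v * (w * x) \<preceq> c"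
    using below_mult_right below_trans by (metis mult.assoc)
  then show "c \<in> ?R"
    using h below_refl unfolding ultrafilter_mult_def by blast
next
  fix c assume "c \<in> ?R"
  then obtain v w x d where h: "v \<in> V" "w \<in> W" "x \<in> X" "w * x \<preceq> d" "v * d \<preceq> c"
    unfolding ultrafilter_mult_def by blast
  then have "v * w * x \<preceq> c"
    using below_mult_left below_trans by (metis mult.assoc)
  then show "c \<in> ?L"
    using h below_refl unfolding ultrafilter_mult_def by blast
qed

sublocale uf: semigroupoid "ultrafilters P" "ultrafilter_dom P z" "ultrafilter_mult P"
proof
  show "ultrafilter_dom P z \<subseteq> ultrafilters P \<times> ultrafilters P"
    by (auto simp: dom_iff)
  show "(V, W) \<in> ultrafilter_dom P z \<and> (ultrafilter_mult P V W, X) \<in> ultrafilter_dom P z \<longleftrightarrow>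
      (W, X) \<in> ultrafilter_dom P z \<and> (V, ultrafilter_mult P W X) \<in> ultrafilter_dom P z"
    if "V \<in> ultrafilters P" "W \<in> ultrafilters P" "X \<in> ultrafilters P" for V W X
    using mult_assoc_dom_iff [OF that] by (rule trans [OF _ sym])
qed (rule ultrafilter_mult_closed ultrafilter_mult_assoc, assumption?)+

section \<open>Source units and composability\<close>

definition src_filter :: "'a set \<Rightarrow> 'a set" where
  "src_filter V = {c. \<exists>v\<in>V. src v \<preceq> c}"

text \<open>Projections \<open>p \<preceq> src v\<close> are matched with the elements
  \<open>v * p\<close> below \<open>v\<close>, since \<open>src (v * p) = p\<close>. This transports
  the disjointness test from \<open>src_filter V\<close> to \<open>V\<close>.\<close>

lemma src_filter_ultrafilter:
  assumes V: "V \<in> ultrafilters P"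
  shows "src_filter V \<in> ultrafilters P"
  unfolding ultrafilter_iff
proof (intro conjI allI impI)
  obtain v where v: "v \<in> V" using ultrafilter_nonempty [OF V] .
  have mem: "src a \<in> src_filter V" if "a \<in> V" for a
    using that below_refl unfolding src_filter_def by blast
  show "poset_filter (proj_order P) (src_filter V)"
  proof (rule filterI)
    show "src v \<in> src_filter V" using mem v .
    show "b \<in> src_filter V" if "a \<in> src_filter V" "a \<preceq> b" for a b
      using that below_trans unfolding src_filter_def by blast
    fix a b assume "a \<in> src_filter V" "b \<in> src_filter V"
    then obtain v1 v2 where "v1 \<in> V" "v2 \<in> V" "src v1 \<preceq> a" "src v2 \<preceq> b"
      unfolding src_filter_def by blast
    then show "\<exists>c\<in>src_filter V. c \<preceq> a \<and> c \<preceq> b"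
      using ultrafilter_lower_bound [OF V] src_mono below_trans mem by metis
  qed
  show "z \<notin> src_filter V"
    using ultrafilter_zero [OF V] unfolding src_filter_def by auto
  fix c assume c: "\<forall>u\<in>src_filter V. \<not> disj c u"
  obtain p where p: "p \<preceq> c" "p \<preceq> src v" "\<And>x. x \<preceq> c \<Longrightarrow> x \<preceq> src v \<Longrightarrow> x \<preceq> p"
    using meet_exists [of c "src v"] by metis
  have pP: "p \<in> P" "src v * p = p"
    using below_projD [OF p(2)] by simp_all
  have "v * p \<in> V"
  proof (rule ultrafilter_mem [OF V])
    fix w' assume "w' \<in> V"
    then obtain w where w: "w \<in> V" "w \<preceq> w'" "w \<preceq> v"
      using ultrafilter_lower_bound [OF V _ v] by blast
    obtain x where x: "x \<preceq> c" "x \<preceq> src w" "x \<noteq> z"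
      using c mem [OF w(1)] by (auto simp: disj_def)
    have "x \<preceq> p"
      using p(3) x src_mono [OF w(3)] below_trans by blast
    have xP: "x \<in> P" "src w * x = x" "p * x = x"
      using below_projD [OF x(2)] below_projD [OF \<open>x \<preceq> p\<close> pP(1)] by simp_all
    have "v * x \<preceq> v * p" 
      using \<open>x \<preceq> p\<close> by (rule below_mult_left)
    \<comment> \<open>Here \<open>w = v * src w\<close>, and \<open>x\<close> absorbs
      \<open>src w\<close>. So \<open>v * x\<close> is also below \<open>w'\<close>, and it is
      nonzero because its source is \<open>x\<close>.\<close>
    moreover have "v * x = w * x"
      using below_eq_mult_src [OF w(3)] xP by (metis mult.assoc)
    moreover have "w * x \<preceq> w'"
      using mult_proj_below [OF xP(1)] w(2) below_trans by blast
    moreover have "src (w * x) = x"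
      using xP by (simp add: src_mult_proj)
    then have "w * x \<noteq> z"
      using x(3) src_proj [OF zero_proj] by metis
    ultimately show "\<not> disj (v * p) w'"
      by (auto simp: disj_def)
  qed
  moreover have "src (v * p) = p"
    using pP by (simp add: src_mult_proj)
  ultimately show "c \<in> src_filter V"
    using p(1) unfolding src_filter_def by force
qed

text \<open>Multiplying by a projection on either side only decreases an element, so
  \<open>W\<close> is contained in the product; comparable ultrafilters are equal.\<close>

lemma unit_if_proj:
  assumes U: "U \<in> ultrafilters P" and p: "p \<in> U" "p \<in> P"
  shows "U \<in> uf.units"
  unfolding uf.units_def
proof (intro CollectI conjI ballI impI U)
  fix W assume "W \<in> ultrafilters P"
  {
    assume D: "(U, W) \<in> ultrafilter_dom P z"
    have "W \<subseteq> ultrafilter_mult P U W"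
    proof
      fix w assume "w \<in> W"
      then show "w \<in> ultrafilter_mult P U W"
        using p proj_mult_le unfolding ultrafilter_mult_def by blast
    qed
    then show "ultrafilter_mult P U W = W"
      using ultrafilter_subset_eq ultrafilter_mult_closed [OF D] \<open>W \<in> _\<close> by blast
  next
    assume D: "(W, U) \<in> ultrafilter_dom P z"
    have "W \<subseteq> ultrafilter_mult P W U"
    proof
      fix w assume "w \<in> W"
      then show "w \<in> ultrafilter_mult P W U"
        using p mult_proj_below unfolding ultrafilter_mult_def by blast
    qed
    then show "ultrafilter_mult P W U = W"
      using ultrafilter_subset_eq ultrafilter_mult_closed [OF D] \<open>W \<in> _\<close> by blast
  }
qed

lemma is_source_unit_src_filter:
  assumes V: "V \<in> ultrafilters P"
  shows "uf.is_source_unit V (src_filter V)"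
proof -
  obtain v where v: "v \<in> V" using ultrafilter_nonempty [OF V] .
  then have "src v \<in> src_filter V"
    using below_refl unfolding src_filter_def by blast
  then have "src_filter V \<in> uf.units"
    using unit_if_proj src_filter_ultrafilter [OF V] src_closed by blast
  moreover have "a * u \<noteq> z" if au: "a \<in> V" "u \<in> src_filter V" for a u
  proof -
    obtain b where b: "b \<in> V" "src b \<preceq> u"
      using au unfolding src_filter_def by blast
    obtain c where c: "c \<in> V" "c \<preceq> a" "c \<preceq> b"
      using ultrafilter_lower_bound [OF V au(1) b(1)] .
    have "c * src c \<preceq> a * u"
      using c b below_mult src_mono below_trans by blast
    then show ?thesis
      using c(1) ultrafilter_zero [OF V] by (metis below_zero mult_src)
  qed
  ultimately show ?thesis
    using V src_filter_ultrafilter [OF V] by (simp add: uf.is_source_unit_def dom_iff)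
qed

lemma source_unit_eq: "V \<in> ultrafilters P \<Longrightarrow> uf.source_unit V = src_filter V"
  unfolding uf.source_unit_def
  by (rule the_equality) (auto dest: is_source_unit_src_filter uf.source_unit_unique)

lemma range_unit_eq: "uf.is_range_unit W U \<Longrightarrow> uf.range_unit W = U"
  unfolding uf.range_unit_def
  by (rule the_equality) (auto dest: uf.range_unit_unique)

sublocale uf: semicategory "ultrafilters P" "ultrafilter_dom P z" "ultrafilter_mult P"
proof
  show "\<exists>u. uf.is_source_unit V u" if "V \<in> ultrafilters P" for V
    using is_source_unit_src_filter that by blast
  have "(V, W) \<in> ultrafilter_dom P z \<longleftrightarrow> V \<in> ultrafilters P \<and> W \<in> ultrafilters P \<and>
     (\<exists>U. uf.is_range_unit W U) \<and> uf.source_unit V = uf.range_unit W" (is "?L \<longleftrightarrow> ?R") for V W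
  proof
    assume L: ?L
    then have V: "V \<in> ultrafilters P" and W: "W \<in> ultrafilters P"
      by (simp_all add: dom_iff)
    have s: "uf.is_source_unit V (src_filter V)"
      by (rule is_source_unit_src_filter [OF V])
    \<comment> \<open>Reading \<open>V\<close> as \<open>V\<close> times its source unit,
      associativity of definedness makes the source unit composable with \<open>W\<close>; being a
      unit, it is then the range unit of \<open>W\<close>.\<close>
    then have "ultrafilter_mult P V (src_filter V) = V"
      using V by (auto simp: uf.is_source_unit_def uf.units_def)
    then have "(src_filter V, W) \<in> ultrafilter_dom P z"
      using uf.assoc_defined [OF V src_filter_ultrafilter [OF V] W] s L
      by (simp add: uf.is_source_unit_def)
    then have "uf.is_range_unit W (src_filter V)"
      using s by (simp add: uf.is_source_unit_def uf.is_range_unit_def)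
    then show ?R
      using V W range_unit_eq source_unit_eq by auto
  next
    assume R: ?R
    then have "uf.is_range_unit W (src_filter V)"
      using range_unit_eq source_unit_eq by metis
    then have D: "(src_filter V, W) \<in> ultrafilter_dom P z"
      by (simp add: uf.is_range_unit_def)
    have "v * w \<noteq> z" if "v \<in> V" "w \<in> W" for v w
    proof -
      have "src v \<in> src_filter V"
        using that below_refl unfolding src_filter_def by blast
      then have "src v * w \<noteq> z"
        using D that by (simp add: dom_iff)
      then show ?thesis
        using mult_eq_zero_iff_src by blast
    qed
    then show ?L
      using R by (simp add: dom_iff)
  qed
  then show "ultrafilter_dom P z = {(V, W). V \<in> ultrafilters P \<and> W \<in> ultrafilters P \<and>
     (\<exists>U. uf.is_range_unit W U) \<and> uf.source_unit V = uf.range_unit W}"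
    by auto
qed


section \<open>Range units\<close>

text \<open>The product of a unit with its source unit equals both factors, so a unit is its own
  source filter and contains the sources of its elements.\<close>

lemma unit_contains_proj:
  assumes "U \<in> uf.units"
  shows "\<exists>p\<in>P. p \<in> U"
proof -
  have U: "U \<in> ultrafilters P"
    using assms by (simp add: uf.units_def)
  have s: "src_filter U \<in> uf.units" "(U, src_filter U) \<in> ultrafilter_dom P z"
    using is_source_unit_src_filter [OF U] by (simp_all add: uf.is_source_unit_def)
  then have "ultrafilter_mult P U (src_filter U) = U"
    "ultrafilter_mult P U (src_filter U) = src_filter U"
    using assms U by (auto simp: uf.units_def)
  then have "U = src_filter U"
    by simp
  moreover obtain u where "u \<in> U" using ultrafilter_nonempty [OF U] .
  then have "src u \<in> src_filter U"
    using below_refl unfolding src_filter_def by blast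
  ultimately show ?thesis
    using src_closed by blast
qed

lemma range_unit_exists_iff:
  assumes W: "W \<in> ultrafilters P"
  shows "(\<exists>U. uf.is_range_unit W U) \<longleftrightarrow> (\<exists>p\<in>P. \<exists>b. p * b \<in> W)"
proof
  assume "\<exists>U. uf.is_range_unit W U"
  then obtain U where U: "U \<in> uf.units" "(U, W) \<in> ultrafilter_dom P z"
    by (auto simp: uf.is_range_unit_def)
  obtain p where "p \<in> P" "p \<in> U"
    using unit_contains_proj [OF U(1)] by blast
  moreover obtain w where "w \<in> W" using ultrafilter_nonempty [OF W] .
  ultimately show "\<exists>p\<in>P. \<exists>b. p * b \<in> W"
    using src_mult_mem [OF U(2)] src_proj by metis
next
  assume "\<exists>p\<in>P. \<exists>b. p * b \<in> W"
  then obtain p b where p: "p \<in> P" and pb: "p * b \<in> W" by blast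
  define w0 where "w0 = p * b"
  have w0: "w0 \<in> W" "p * w0 = w0"
    using p pb by (simp_all add: w0_def mult.assoc [symmetric] proj_idem)
  define F where "F = {q \<in> P. \<forall>w\<in>W. q * w \<in> W}"
  \<comment> \<open>One \<open>w\<close> with \<open>q * w \<in> W\<close> suffices: every
    \<open>u\<close> below \<open>q * w\<close> is fixed by \<open>q\<close>, and such
    \<open>u\<close> occur below each element of \<open>W\<close>.\<close>
  have F_iff: "q \<in> F" if q: "q \<in> P" "w \<in> W" "q * w \<in> W" for q w
  proof -
    have "q * w' \<in> W" if w': "w' \<in> W" for w'
    proof -
      obtain u where u: "u \<in> W" "u \<preceq> q * w" "u \<preceq> w'"
        using ultrafilter_lower_bound [OF W q(3) w'] .
      then have "q * u = u"
        using q(1) below_eq_mult_src [OF u(2)] proj_idem by (metis mult.assoc)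
      then show ?thesis
        using u below_mult_left [OF u(3), of q] ultrafilter_up [OF W] by metis
    qed
    then show ?thesis
      using q(1) by (simp add: F_def)
  qed
  have pF: "p \<in> F"
    using F_iff [OF p w0(1)] w0 by simp
  define U where "U = {c. \<exists>q\<in>F. q \<preceq> c}"
  have FU: "F \<subseteq> U"
    using below_refl unfolding U_def by blast
  have U: "U \<in> ultrafilters P"
    unfolding ultrafilter_iff
  proof (intro conjI allI impI)
    show "poset_filter (proj_order P) U"
    proof (rule filterI)
      show "p \<in> U" using pF FU by blast
      show "b \<in> U" if "a \<in> U" "a \<preceq> b" for a b
        using that below_trans unfolding U_def by blast
      fix a b assume "a \<in> U" "b \<in> U"
      then obtain q r where qr: "q \<in> F" "r \<in> F" "q \<preceq> a" "r \<preceq> b"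
        unfolding U_def by blast
      then have "q * r \<in> F"
        by (auto simp: F_def proj_closed mult.assoc)
      moreover have "q \<in> P" "r \<in> P"
        using qr by (simp_all add: F_def)
      then have "q * r \<preceq> a" "q * r \<preceq> b"
        using below_trans [OF mult_proj_below qr(3)] below_trans [OF proj_mult_le qr(4)] by blast+
      ultimately show "\<exists>c\<in>U. c \<preceq> a \<and> c \<preceq> b"
        using FU by blast
    qed
    show "z \<notin> U"
    proof
      assume "z \<in> U"
      then have "z \<in> F"
        by (simp add: U_def)
      then have "z * w0 \<in> W"
        using w0(1) by (simp add: F_def)
      then show False
        using ultrafilter_zero [OF W] by (simp add: zero_mult)
    qed
    fix c assume c: "\<forall>u\<in>U. \<not> disj c u"
    \<comment> \<open>Split \<open>p\<close> into its part \<open>q\<close> below \<open>c\<close>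
      and the complement \<open>r\<close>. Since \<open>p\<close> fixes \<open>w0\<close>, right
      distributivity writes \<open>w0\<close> as the join of \<open>q * w0\<close> and
      \<open>r * w0\<close>, and primality puts one of them in \<open>W\<close>.\<close>
    obtain q where q: "q \<preceq> c" "q \<preceq> p" "\<And>x. x \<preceq> c \<Longrightarrow> x \<preceq> p \<Longrightarrow> x \<preceq> q"
      using meet_exists [of c p] by metis
    obtain r where r: "r \<preceq> p" "disj q r" "\<And>u. q \<preceq> u \<Longrightarrow> r \<preceq> u \<Longrightarrow> p \<preceq> u"
      using complement_exists [OF q(2)] by metis
    have qrP: "q \<in> P" "r \<in> P"
      using below_projD(1) q(2) r(1) p by blast+
    have join: "least (proj_order P) (x \<squnion>\<^bsub>proj_order P\<^esub> y) (Upper (proj_order P) {x, y})"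
      if "x \<preceq> t" "y \<preceq> t" for x y t
      using bounded_lub_exists [OF that] unfolding join_def sup_def
      by (metis (mono_tags, lifting) someI_ex)
    have "q \<squnion>\<^bsub>proj_order P\<^esub> r = p"
      using join [OF q(2) r(1)] r q(2) unfolding lub_iff by (intro below_antisym) auto
    moreover have "p \<in> Upper (proj_order P) {q, r}"
      using q r by (auto simp: Upper_def proj_order_def)
    ultimately have w0_join: "(q * w0) \<squnion>\<^bsub>proj_order P\<^esub> (r * w0) = w0"
      using join_mult [of q r w0] w0(2) by force
    have "least (proj_order P) w0 (Upper (proj_order P) {q * w0, r * w0})"
      using join [OF proj_mult_le [OF qrP(1), of w0] proj_mult_le [OF qrP(2), of w0]]
      unfolding w0_join .
    then have "\<exists>a\<in>{q * w0, r * w0}. a \<in> W"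
      by (intro ultrafilter_prime [OF W w0(1)]) simp_all
    then have "q * w0 \<in> W \<or> r * w0 \<in> W"
      by simp
    then have "q \<in> F \<or> r \<in> F"
      using F_iff w0(1) qrP by blast
    \<comment> \<open>Anything below \<open>c\<close> and \<open>r\<close> is below
      \<open>p\<close>, hence below \<open>q\<close>, hence zero; so \<open>r\<close> is disjoint
      from \<open>c\<close> and cannot lie in \<open>U\<close>.\<close>
    moreover have "r \<notin> F"
    proof
      assume "r \<in> F"
      then obtain x where "x \<preceq> c" "x \<preceq> r" "x \<noteq> z"
        using c FU by (auto simp: disj_def)
      then show False
        using q(3) r(1,2) below_trans unfolding disj_def by blast
    qed
    ultimately show "c \<in> U"
      using q(1) unfolding U_def by blast
  qed
  have "u * w \<noteq> z" if uw: "u \<in> U" "w \<in> W" for u w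
  proof -
    obtain q where "q \<in> F" "q \<preceq> u"
      using uw unfolding U_def by blast
    then have "q * w \<in> W" "q * w \<preceq> u * w"
      using uw below_mult_right by (auto simp: F_def)
    then show ?thesis
      using ultrafilter_zero [OF W] by (metis below_zero)
  qed
  then have "uf.is_range_unit W U"
    using unit_if_proj [OF U _ p] pF FU U W by (simp add: uf.is_range_unit_def dom_iff subset_iff)
  then show "\<exists>U. uf.is_range_unit W U" ..
qed

section \<open>The category criterion and compactness\<close>

lemma category_iff:
  "category (ultrafilters P) (ultrafilter_dom P z) (ultrafilter_mult P) \<longleftrightarrow>
     (\<forall>W\<in>ultrafilters P. \<exists>p\<in>P. \<exists>b. p * b \<in> W)"
  using uf.semicategory_axioms range_unit_exists_iff
  by (auto simp: category_def category_axioms_def)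

text \<open>
  For the direction from left to right, take an element \<open>b\<close> that is not a finite join of elements of
  \<open>X\<close>. The elements that lie above the complement, relative to \<open>b\<close>, of some finite subset of \<open>X\<close>
  form a proper filter, and no ultrafilter extending it meets \<open>X\<close>.
\<close>

lemma ultrafilters_meet_iff_finite_joins:
  assumes down: "\<And>x y. x \<in> X \<Longrightarrow> y \<preceq> x \<Longrightarrow> y \<in> X"
  shows "(\<forall>W\<in>ultrafilters P. W \<inter> X \<noteq> {}) \<longleftrightarrow> (\<forall>b. is_finite_join_of (proj_order P) X b)"
proof
  assume R: "\<forall>b. is_finite_join_of (proj_order P) X b"
  show "\<forall>W\<in>ultrafilters P. W \<inter> X \<noteq> {}"
  proof
    fix W assume W: "W \<in> ultrafilters P"
    obtain b where "b \<in> W" using ultrafilter_nonempty [OF W] .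
    then show "W \<inter> X \<noteq> {}"
      using R ultrafilter_prime [OF W] unfolding is_finite_join_of_def by blast
  qed
next
  assume L: "\<forall>W\<in>ultrafilters P. W \<inter> X \<noteq> {}"
  show "\<forall>b. is_finite_join_of (proj_order P) X b"
  proof (rule ccontr)
    assume "\<not> ?thesis"
    then obtain b where b: "\<not> is_finite_join_of (proj_order P) X b" by blast
    \<comment> \<open>The last clause says that \<open>c\<close> is above the complement of the join
      of \<open>A\<close> in \<open>b\<close>, without forming that join. The empty \<open>A\<close>
      yields \<open>b\<close> itself, and unions of such sets \<open>A\<close> handle meets.\<close>
    define F where "F = {c. \<exists>A. finite A \<and> A \<subseteq> X \<and> (\<forall>a\<in>A. a \<preceq> b) \<and>
      (\<forall>x. x \<preceq> b \<longrightarrow> (\<forall>a\<in>A. disj x a) \<longrightarrow> x \<preceq> c)}"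
    have bF: "b \<in> F"
      unfolding F_def by blast
    have "poset_filter (proj_order P) F"
    proof (rule filterI)
      show "b \<in> F" by fact
      show "d \<in> F" if cd: "c \<in> F" "c \<preceq> d" for c d
      proof -
        obtain A where "finite A" "A \<subseteq> X" "\<forall>a\<in>A. a \<preceq> b"
          "\<forall>x. x \<preceq> b \<longrightarrow> (\<forall>a\<in>A. disj x a) \<longrightarrow> x \<preceq> c"
          using cd(1) unfolding F_def by blast
        then show ?thesis
          unfolding F_def using below_trans [OF _ cd(2)] by (intro CollectI exI [of _ A]) simp
      qed
      fix c d assume "c \<in> F" "d \<in> F"
      then obtain A A' where
        A: "finite A" "A \<subseteq> X" "\<forall>a\<in>A. a \<preceq> b" "\<forall>x. x \<preceq> b \<longrightarrow> (\<forall>a\<in>A. disj x a) \<longrightarrow> x \<preceq> c" and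
        A': "finite A'" "A' \<subseteq> X" "\<forall>a\<in>A'. a \<preceq> b" "\<forall>x. x \<preceq> b \<longrightarrow> (\<forall>a\<in>A'. disj x a) \<longrightarrow> x \<preceq> d"
        unfolding F_def by blast
      obtain m where m: "m \<preceq> c" "m \<preceq> d" "\<And>x. x \<preceq> c \<Longrightarrow> x \<preceq> d \<Longrightarrow> x \<preceq> m"
        using meet_exists [of c d] by metis
      have "m \<in> F"
        unfolding F_def using A A' m(3) by (intro CollectI exI [of _ "A \<union> A'"]) auto
      then show "\<exists>m\<in>F. m \<preceq> c \<and> m \<preceq> d"
        using m by blast
    qed
    moreover have "z \<notin> F"
    proof
      assume "z \<in> F"
      then obtain A where A: "finite A" "A \<subseteq> X" "\<forall>a\<in>A. a \<preceq> b"
          "\<And>x. x \<preceq> b \<Longrightarrow> (\<forall>a\<in>A. disj x a) \<Longrightarrow> x = z"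
        unfolding F_def by auto
      \<comment> \<open>If \<open>z \<in> F\<close>, only zero is below \<open>b\<close> and
        disjoint from all of \<open>A\<close>. The complement in \<open>b\<close> of the meet of
        \<open>u\<close> and \<open>b\<close> is such an element, so \<open>b \<preceq> u\<close>
        and \<open>b\<close> would be the join of \<open>A\<close>.\<close>
      have "b \<preceq> u" if u: "\<forall>a\<in>A. a \<preceq> u" for u
      proof -
        obtain w where w: "w \<preceq> u" "w \<preceq> b" "\<And>x. x \<preceq> u \<Longrightarrow> x \<preceq> b \<Longrightarrow> x \<preceq> w"
          using meet_exists [of u b] by metis
        obtain w' where w': "w' \<preceq> b" "disj w w'" "\<And>u. w \<preceq> u \<Longrightarrow> w' \<preceq> u \<Longrightarrow> b \<preceq> u"
          using complement_exists [OF w(2)] by metis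
        have "\<forall>a\<in>A. disj w' a"
          using w'(2) w(3) u A(3) below_trans unfolding disj_def by blast
        then have "w' = z"
          using A(4) w'(1) by blast
        then show ?thesis
          using w'(3) w(1) by simp
      qed
      then have "is_finite_join_of (proj_order P) X b"
        using A unfolding is_finite_join_of_def lub_iff by blast
      then show False
        using b by blast
    qed
    ultimately obtain U where U: "U \<in> ultrafilters P" "F \<subseteq> U"
      using filter_extends_to_ultrafilter by blast
    obtain x where x: "x \<in> U" "x \<in> X"
      using L U(1) by blast
    \<comment> \<open>Moving from \<open>x\<close> to \<open>y \<preceq> b\<close> stays in the
      down-set \<open>X\<close>, so the singleton \<open>{y}\<close> puts the complement
      \<open>y'\<close> of \<open>y\<close> into \<open>F\<close>. Then \<open>U\<close> contains
      two disjoint elements.\<close>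
    obtain y where y: "y \<in> U" "y \<preceq> x" "y \<preceq> b"
      using ultrafilter_lower_bound [OF U(1) x(1)] U(2) bF by blast
    obtain y' where y': "y' \<preceq> b" "disj y y'" "\<And>x. x \<preceq> b \<Longrightarrow> disj x y \<Longrightarrow> x \<preceq> y'"
      using complement_exists [OF y(3)] by metis
    have "y' \<in> F"
      unfolding F_def using y' y x down by (intro CollectI exI [of _ "{y}"]) auto
    then obtain u where "u \<in> U" "u \<preceq> y" "u \<preceq> y'"
      using ultrafilter_lower_bound [OF U(1) y(1)] U(2) by blast
    then show False
      using y'(2) ultrafilter_zero [OF U(1)] by (auto simp: disj_def)
  qed
qed

end

theorem proposition6p7:
  fixes P :: "'a::semigroup_mult set" and z :: 'a
  assumes "semi_boolean_restriction_semigroup P z"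
  shows "category (ultrafilters P) (ultrafilter_dom P z) (ultrafilter_mult P) \<longleftrightarrow>
         (\<forall>b. is_finite_join_of (proj_order P) {p * x | p x. p \<in> P} b)"
proof -
  interpret semi_boolean_restriction_semigroup P z
    by (rule assms)
  let ?PB = "{p * x | p x. p \<in> P}"
  \<comment> \<open>By associativity, restricting \<open>p * x\<close> by a projection on the right
    only changes \<open>x\<close>.\<close>
  have "b \<in> ?PB" if "a \<in> ?PB" "b \<preceq> a" for a b
    using that by (fastforce simp: below_iff mult.assoc)
  then have "(\<forall>W\<in>ultrafilters P. W \<inter> ?PB \<noteq> {}) \<longleftrightarrow> (\<forall>b. is_finite_join_of (proj_order P) ?PB b)"
    by (rule ultrafilters_meet_iff_finite_joins)
  moreover have "W \<inter> ?PB \<noteq> {} \<longleftrightarrow> (\<exists>p\<in>P. \<exists>b. p * b \<in> W)" for W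
    by blast
  ultimately show ?thesis
    unfolding category_iff by simp
qed

end
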